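(* Let $$\mathbb{T}=\{(n_1,n_2,n_3)\in\mathbb{N}^3:n_1<n_2<n_3,\ \lambda_{n_3}<-\beta\ \text{and}\ \lambda_{n_1}(\lambda_{n_3}-\lambda_{n_1})=\lambda_{n_2}(\lambda_{n_3}-\lambda_{n_2})=2k\}.$$ The system $$A^2u+C_uAu+k(u-v)=0,\qquad A^2v+C_vAv-k(u-v)=0,$$ with $C_u=\beta+\varrho\|u\|_1^2$, $C_v=\beta+\varrho\|v\|_1^2$, admits trimodal equidistributed energy solutions if and only if $\mathbb{T}$ is nonempty. More precisely, for every triplet $(n_1,n_2,n_3)\in\mathbb{N}^3$ with $n_1<n_2<n_3$, one of the following disjoint situations occurs. (1) If $(n_1,n_2,n_3)\in\mathbb{T}$, the trimodal equidistributed energy solutions involving $e_{n_1},e_{n_2},e_{n_3}$ are exactly the (infinitely many) couples $$u=xe_{n_1}+ye_{n_2}+ze_{n_3},\qquad v=-xe_{n_1}-ye_{n_2}+ze_{n_3},$$ for all $(x,y,z)\in\mathbb{R}^3$ satisfying $\varrho x^2\lambda_{n_1}+\varrho y^2\lambda_{n_2}+\varrho z^2\lambda_{n_3}+\lambda_{n_3}+\beta=0$ with $xyz\neq0$. (2) If $(n_1,n_2,n_3)\notin\mathbb{T}$, there are no trimodal equidistributed energy solutions involving the eigenvectors $e_{n_1},e_{n_2},e_{n_3}$.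
   Context: Let $H$ be a separable real Hilbert space with inner product $\langle\cdot,\cdot\rangle$ and norm $\|\cdot\|$, and let $A:D(A)\subset H\to H$ be a strictly positive selfadjoint linear operator whose domain is densely and compactly embedded in $H$. For $r\ge0$ set $H^r=D(A^{r/2})$, $\langle u,v\rangle_r=\langle A^{r/2}u,A^{r/2}v\rangle$, $\|u\|_r=\|A^{r/2}u\|$. All eigenvalues of $A$ are assumed simple; they form the increasing sequence $0<\lambda_1<\lambda_2<\cdots\to\infty$ ($n\in\mathbb{N}=\{1,2,3,\dots\}$), and the corresponding normalized eigenvectors $e_n$ form a complete orthonormal basis of $H$. Fix $\beta\in\mathbb{R}$ and $\varrho,k>0$. A (weak) solution of the system is a couple $(u,v)\in H^2\times H^2$ such that $$\langle u,\phi\rangle_2+C_u\langle u,\phi\rangle_1+k\langle u-v,\phi\rangle=0,\qquad \langle v,\psi\rangle_2+C_v\langle v,\psi\rangle_1-k\langle u-v,\psi\rangle=0$$ for every $(\phi,\psi)\in H^2\times H^2$. A solution is trimodal, involving $e_{n_1},e_{n_2},e_{n_3}$ (distinct indices), if $u=\sum_{i=1}^3\alpha_{n_i}e_{n_i}$ and $v=\sum_{i=1}^3\gamma_{n_i}e_{n_i}$ with all $\alpha_{n_i},\gamma_{n_i}$ nonzero reals. An equidistributed energy solution is a nontrivial solution $(u,v)$ with $\|u\|_1=\|v\|_1$ (equivalently $C_u=C_v$). *)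

theory Defs
  imports "HOL-Analysis.Analysis"
begin

section \<open>Unbounded operators, given by a domain and a function used on that domain only\<close>

definition linear_on_dom :: "'a::real_inner set \<Rightarrow> ('a \<Rightarrow> 'a) \<Rightarrow> bool" where
  "linear_on_dom D A \<longleftrightarrow> subspace D \<and>
     (\<forall>x\<in>D. \<forall>y\<in>D. A (x + y) = A x + A y) \<and> (\<forall>c. \<forall>x\<in>D. A (c *\<^sub>R x) = c *\<^sub>R A x)"

text \<open>The last conjunct says that the graph of the adjoint of the operator (well defined
  because the domain is dense) equals the graph of the operator; this is selfadjointness
  proper, not just symmetry.\<close>

definition selfadjoint_op :: "'a::real_inner set \<Rightarrow> ('a \<Rightarrow> 'a) \<Rightarrow> bool" where
  "selfadjoint_op D A \<longleftrightarrow> linear_on_dom D A \<and> closure D = UNIV \<and>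
     (\<forall>u w. (\<forall>\<phi>\<in>D. A \<phi> \<bullet> u = \<phi> \<bullet> w) \<longleftrightarrow> u \<in> D \<and> w = A u)"

definition strictly_positive_op :: "'a::real_inner set \<Rightarrow> ('a \<Rightarrow> 'a) \<Rightarrow> bool" where
  "strictly_positive_op D A \<longleftrightarrow> (\<forall>u\<in>D. u \<noteq> 0 \<longrightarrow> A u \<bullet> u > 0)"

text \<open>The domain carries the graph norm; compactness of the embedding means that its unit
  ball is relatively compact in the ambient space.\<close>

definition compactly_embedded_dom :: "'a::real_inner set \<Rightarrow> ('a \<Rightarrow> 'a) \<Rightarrow> bool" where
  "compactly_embedded_dom D A \<longleftrightarrow> compact (closure {u \<in> D. norm u + norm (A u) \<le> 1})"

definition eigenspace :: "'a::real_inner set \<Rightarrow> ('a \<Rightarrow> 'a) \<Rightarrow> real \<Rightarrow> 'a set" where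
  "eigenspace D A \<mu> = {u \<in> D. A u = \<mu> *\<^sub>R u}"

definition eigenvalues :: "'a::real_inner set \<Rightarrow> ('a \<Rightarrow> 'a) \<Rightarrow> real set" where
  "eigenvalues D A = {\<mu>. \<exists>u \<in> eigenspace D A \<mu>. u \<noteq> 0}"

section \<open>The standing assumptions\<close>

text \<open>Eigenvalues \<open>lam n\<close> and eigenvectors \<open>e n\<close> are indexed by \<open>n \<ge> 1\<close>; the values at \<open>0\<close>
  are irrelevant. The assumptions \<open>lam_at_top\<close> and \<open>eigenvectors_complete\<close> are classical
  consequences of the others, and are recorded here as part of the spectral data.\<close>

locale simple_spectrum_operator =
  fixes D :: "'a::{real_inner, banach, second_countable_topology} set"
    and A :: "'a \<Rightarrow> 'a"
    and lam :: "nat \<Rightarrow> real"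
    and e :: "nat \<Rightarrow> 'a"
  assumes selfadjoint: "selfadjoint_op D A"
    and strictly_positive: "strictly_positive_op D A"
    and compactly_embedded: "compactly_embedded_dom D A"
    and simple_eigenvalues: "\<And>\<mu>. \<mu> \<in> eigenvalues D A \<Longrightarrow> dim (eigenspace D A \<mu>) = 1"
    and lam_strict_mono: "strict_mono_on {1..} lam"
    and lam_eigenvalues: "lam ` {1..} = eigenvalues D A"
    and lam_at_top: "filterlim lam at_top sequentially"
    and eigenvectors: "\<And>n. n \<ge> 1 \<Longrightarrow> e n \<in> eigenspace D A (lam n)"
    and eigenvectors_normalized: "\<And>n. n \<ge> 1 \<Longrightarrow> norm (e n) = 1"
    and eigenvectors_complete: "closure (span (e ` {1..})) = UNIV"

section \<open>Fractional powers and the spaces \<open>H\<^sup>r\<close>\<close>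

text \<open>The power \<open>A\<^sup>s\<close> is defined by functional calculus: it multiplies the \<open>n\<close>-th Fourier
  coefficient by \<open>lam n powr s\<close>, on the domain where the result is square summable. The
  lemmas at the end of this theory confirm that the power of exponent 1 is the operator
  itself, with the same domain.\<close>

definition pow_dom :: "(nat \<Rightarrow> real) \<Rightarrow> (nat \<Rightarrow> 'a::real_inner) \<Rightarrow> real \<Rightarrow> 'a set" where
  "pow_dom lam e s = {u. (\<lambda>n. (lam n powr s * (u \<bullet> e n))\<^sup>2) summable_on {1..}}"

definition pow_op :: "(nat \<Rightarrow> real) \<Rightarrow> (nat \<Rightarrow> 'a::real_inner) \<Rightarrow> real \<Rightarrow> 'a \<Rightarrow> 'a" where
  "pow_op lam e s u = (\<Sum>\<^sub>\<infinity>n\<in>{1..}. (lam n powr s * (u \<bullet> e n)) *\<^sub>R e n)"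

definition H_space :: "(nat \<Rightarrow> real) \<Rightarrow> (nat \<Rightarrow> 'a::real_inner) \<Rightarrow> real \<Rightarrow> 'a set" where
  "H_space lam e r = pow_dom lam e (r / 2)"

definition H_inner :: "(nat \<Rightarrow> real) \<Rightarrow> (nat \<Rightarrow> 'a::real_inner) \<Rightarrow> real \<Rightarrow> 'a \<Rightarrow> 'a \<Rightarrow> real" where
  "H_inner lam e r u v = pow_op lam e (r / 2) u \<bullet> pow_op lam e (r / 2) v"

definition H_norm :: "(nat \<Rightarrow> real) \<Rightarrow> (nat \<Rightarrow> 'a::real_inner) \<Rightarrow> real \<Rightarrow> 'a \<Rightarrow> real" where
  "H_norm lam e r u = norm (pow_op lam e (r / 2) u)"

section \<open>Solutions of the system\<close>

definition C_coeff ::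
    "(nat \<Rightarrow> real) \<Rightarrow> (nat \<Rightarrow> 'a::real_inner) \<Rightarrow> real \<Rightarrow> real \<Rightarrow> 'a \<Rightarrow> real" where
  "C_coeff lam e \<beta> \<rho> u = \<beta> + \<rho> * (H_norm lam e 1 u)\<^sup>2"

definition weak_solution ::
    "(nat \<Rightarrow> real) \<Rightarrow> (nat \<Rightarrow> 'a::real_inner) \<Rightarrow> real \<Rightarrow> real \<Rightarrow> real \<Rightarrow> 'a \<Rightarrow> 'a \<Rightarrow> bool" where
  "weak_solution lam e \<beta> \<rho> k u v \<longleftrightarrow>
     u \<in> H_space lam e 2 \<and> v \<in> H_space lam e 2 \<and>
     (\<forall>\<phi> \<in> H_space lam e 2. \<forall>\<psi> \<in> H_space lam e 2.
        H_inner lam e 2 u \<phi> + C_coeff lam e \<beta> \<rho> u * H_inner lam e 1 u \<phi> + k * ((u - v) \<bullet> \<phi>) = 0 \<and>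
        H_inner lam e 2 v \<psi> + C_coeff lam e \<beta> \<rho> v * H_inner lam e 1 v \<psi> - k * ((u - v) \<bullet> \<psi>) = 0)"

definition trimodal ::
    "(nat \<Rightarrow> 'a::real_inner) \<Rightarrow> nat \<Rightarrow> nat \<Rightarrow> nat \<Rightarrow> 'a \<Rightarrow> 'a \<Rightarrow> bool" where
  "trimodal e n\<^sub>1 n\<^sub>2 n\<^sub>3 u v \<longleftrightarrow>
     n\<^sub>1 \<ge> 1 \<and> n\<^sub>2 \<ge> 1 \<and> n\<^sub>3 \<ge> 1 \<and> distinct [n\<^sub>1, n\<^sub>2, n\<^sub>3] \<and>
     (\<exists>\<alpha> \<gamma> :: nat \<Rightarrow> real.
        (\<forall>n \<in> {n\<^sub>1, n\<^sub>2, n\<^sub>3}. \<alpha> n \<noteq> 0 \<and> \<gamma> n \<noteq> 0) \<and>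
        u = (\<Sum>n \<in> {n\<^sub>1, n\<^sub>2, n\<^sub>3}. \<alpha> n *\<^sub>R e n) \<and>
        v = (\<Sum>n \<in> {n\<^sub>1, n\<^sub>2, n\<^sub>3}. \<gamma> n *\<^sub>R e n))"

definition equidistributed_solution ::
    "(nat \<Rightarrow> real) \<Rightarrow> (nat \<Rightarrow> 'a::real_inner) \<Rightarrow> real \<Rightarrow> real \<Rightarrow> real \<Rightarrow> 'a \<Rightarrow> 'a \<Rightarrow> bool" where
  "equidistributed_solution lam e \<beta> \<rho> k u v \<longleftrightarrow>
     weak_solution lam e \<beta> \<rho> k u v \<and> (u, v) \<noteq> (0, 0) \<and> H_norm lam e 1 u = H_norm lam e 1 v"

definition trimodal_EE ::
    "(nat \<Rightarrow> real) \<Rightarrow> (nat \<Rightarrow> 'a::real_inner) \<Rightarrow> real \<Rightarrow> real \<Rightarrow> real \<Rightarrow>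
     nat \<Rightarrow> nat \<Rightarrow> nat \<Rightarrow> ('a \<times> 'a) set" where
  "trimodal_EE lam e \<beta> \<rho> k n\<^sub>1 n\<^sub>2 n\<^sub>3 =
     {(u, v). equidistributed_solution lam e \<beta> \<rho> k u v \<and> trimodal e n\<^sub>1 n\<^sub>2 n\<^sub>3 u v}"

definition T_set :: "(nat \<Rightarrow> real) \<Rightarrow> real \<Rightarrow> real \<Rightarrow> (nat \<times> nat \<times> nat) set" where
  "T_set lam \<beta> k =
     {(n\<^sub>1, n\<^sub>2, n\<^sub>3). 1 \<le> n\<^sub>1 \<and> n\<^sub>1 < n\<^sub>2 \<and> n\<^sub>2 < n\<^sub>3 \<and> lam n\<^sub>3 < - \<beta> \<and>
        lam n\<^sub>1 * (lam n\<^sub>3 - lam n\<^sub>1) = 2 * k \<and> lam n\<^sub>2 * (lam n\<^sub>3 - lam n\<^sub>2) = 2 * k}"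

section \<open>The power of exponent 1 is the operator itself\<close>

context simple_spectrum_operator
begin

lemma e_dom: "n \<ge> 1 \<Longrightarrow> e n \<in> D"
  and A_e: "n \<ge> 1 \<Longrightarrow> A (e n) = lam n *\<^sub>R e n"
  using eigenvectors by (auto simp: eigenspace_def)

lemma A_sym: "u \<in> D \<Longrightarrow> v \<in> D \<Longrightarrow> A u \<bullet> v = u \<bullet> A v"
  using selfadjoint unfolding selfadjoint_op_def by blast

lemma lam_pos: assumes "n \<ge> 1" shows "lam n > 0"
proof -
  have "e n \<noteq> 0" using eigenvectors_normalized[OF assms] by auto
  then have "A (e n) \<bullet> e n > 0"
    using strictly_positive e_dom[OF assms] unfolding strictly_positive_op_def by blast
  then show ?thesis using A_e[OF assms] eigenvectors_normalized[OF assms]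
    by (simp add: dot_square_norm)
qed

lemma orthonormal:
  assumes "m \<ge> 1" "n \<ge> 1"
  shows "e m \<bullet> e n = (if m = n then 1 else 0)"
proof (cases "m = n")
  case True
  then show ?thesis using eigenvectors_normalized[OF assms(1)] by (simp add: dot_square_norm)
next
  case False
  have "lam m * (e m \<bullet> e n) = lam n * (e m \<bullet> e n)"
    using A_sym[OF e_dom[OF assms(1)] e_dom[OF assms(2)]] A_e[OF assms(1)] A_e[OF assms(2)]
    by simp
  moreover have "lam m \<noteq> lam n"
    using strict_mono_on_imp_inj_on[OF lam_strict_mono] assms False
    by (auto simp: inj_on_def)
  ultimately show ?thesis using False by simp
qed

lemma sum_inner_e:
  assumes "finite F" "F \<subseteq> {1..}" "m \<ge> 1"
  shows "(\<Sum>n\<in>F. c n *\<^sub>R e n) \<bullet> e m = (if m \<in> F then c m else 0)"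
proof -
  have "(\<Sum>n\<in>F. c n *\<^sub>R e n) \<bullet> e m = (\<Sum>n\<in>F. if m = n then c n else 0)"
    unfolding inner_sum_left
    by (rule sum.cong) (use assms orthonormal in auto)
  then show ?thesis using assms by simp
qed

lemma norm_sum_e:
  assumes "finite F" "F \<subseteq> {1..}"
  shows "(norm (\<Sum>n\<in>F. c n *\<^sub>R e n))\<^sup>2 = (\<Sum>n\<in>F. (c n)\<^sup>2)"
proof -
  have "(\<Sum>n\<in>F. c n *\<^sub>R e n) \<bullet> (\<Sum>n\<in>F. c n *\<^sub>R e n) = (\<Sum>m\<in>F. c m * ((\<Sum>n\<in>F. c n *\<^sub>R e n) \<bullet> e m))"
    by (subst inner_sum_right) simp
  also have "\<dots> = (\<Sum>n\<in>F. (c n)\<^sup>2)"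
  proof (rule sum.cong)
    fix m assume "m \<in> F"
    moreover from this have "m \<ge> 1" using assms(2) by auto
    ultimately show "c m * ((\<Sum>n\<in>F. c n *\<^sub>R e n) \<bullet> e m) = (c m)\<^sup>2"
      using sum_inner_e[OF assms, of m c] by (simp add: power2_eq_square)
  qed simp
  finally show ?thesis by (simp add: dot_square_norm)
qed

lemma fourier_has_sum: "((\<lambda>n. (u \<bullet> e n) *\<^sub>R e n) has_sum u) {1..}"
  unfolding has_sum_def
proof (rule tendstoI)
  fix \<epsilon> :: real assume "\<epsilon> > 0"
  have "u \<in> closure (span (e ` {1..}))" using eigenvectors_complete by simp
  then obtain w where w: "w \<in> span (e ` {1..})" "dist w u < \<epsilon>"
    using \<open>\<epsilon> > 0\<close> unfolding closure_approachable by blast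
  obtain t r where t: "finite t" "t \<subseteq> e ` {1..}" "w = (\<Sum>a\<in>t. r a *\<^sub>R a)"
    using w(1) unfolding span_explicit by blast
  obtain G where G: "finite G" "G \<subseteq> {1..}" "t = e ` G"
    using finite_subset_image[OF t(1,2)] by blast
  have dist: "dist (\<Sum>n\<in>F. (u \<bullet> e n) *\<^sub>R e n) u < \<epsilon>"
    if F: "finite F" "F \<subseteq> {1..}" "G \<subseteq> F" for F
  proof -
    define S where "S = (\<Sum>n\<in>F. (u \<bullet> e n) *\<^sub>R e n)"
    have 0: "(u - S) \<bullet> e m = 0" if "m \<in> F" for m
      using sum_inner_e[OF F(1,2), of m "\<lambda>n. u \<bullet> e n"] that F(2)
      by (auto simp: S_def inner_diff_left)
    have "orthogonal (u - S) (S - w)"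
    proof -
      have "(u - S) \<bullet> S = 0"
        by (subst (2) S_def, unfold inner_sum_right) (rule sum.neutral, use 0 in simp)
      moreover have "(u - S) \<bullet> w = 0"
        unfolding t(3) inner_sum_right
        by (rule sum.neutral) (use 0 G F in auto)
      ultimately show ?thesis by (simp add: orthogonal_def inner_diff_right)
    qed
    then have "(norm (u - w))\<^sup>2 = (norm (u - S))\<^sup>2 + (norm (S - w))\<^sup>2"
      using norm_add_Pythagorean[of "u - S" "S - w"] by simp
    then have "(norm (u - S))\<^sup>2 \<le> (norm (u - w))\<^sup>2" by simp
    then have "norm (u - S) \<le> norm (u - w)"
      using power2_le_imp_le norm_ge_zero by blast
    then show ?thesis using w(2) by (simp add: S_def dist_norm norm_minus_commute)
  qed
  show "\<forall>\<^sub>F F in finite_subsets_at_top {1..}. dist (\<Sum>n\<in>F. (u \<bullet> e n) *\<^sub>R e n) u < \<epsilon>"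
    unfolding eventually_finite_subsets_at_top using G dist by blast
qed

lemma riesz_fischer:
  assumes "(\<lambda>n. (c n)\<^sup>2) summable_on {1..}"
  shows "(\<lambda>n. c n *\<^sub>R e n) summable_on {1..}"
proof -
  let ?at = "finite_subsets_at_top {1::nat..}"
  have cauchy: "\<exists>P. eventually P ?at \<and>
      (\<forall>F F'. P F \<and> P F' \<longrightarrow> dist (\<Sum>n\<in>F. c n *\<^sub>R e n) (\<Sum>n\<in>F'. c n *\<^sub>R e n) < \<epsilon>)"
    if "\<epsilon> > 0" for \<epsilon> :: real
  proof -
    obtain s where "((\<lambda>n. (c n)\<^sup>2) has_sum s) {1..}" using assms unfolding summable_on_def by auto
    then have "eventually (\<lambda>F. dist (\<Sum>n\<in>F. (c n)\<^sup>2) s < (\<epsilon> / 2)\<^sup>2 / 2) ?at"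
      using that unfolding has_sum_def by (intro tendstoD) auto
    then obtain G where G: "finite G" "G \<subseteq> {1..}"
      and near: "\<And>F. finite F \<Longrightarrow> G \<subseteq> F \<Longrightarrow> F \<subseteq> {1..} \<Longrightarrow> dist (\<Sum>n\<in>F. (c n)\<^sup>2) s < (\<epsilon> / 2)\<^sup>2 / 2"
      unfolding eventually_finite_subsets_at_top by metis
    have half: "dist (\<Sum>n\<in>F. c n *\<^sub>R e n) (\<Sum>n\<in>G. c n *\<^sub>R e n) < \<epsilon> / 2"
      if F: "finite F" "G \<subseteq> F" "F \<subseteq> {1..}" for F
    proof -
      have "(norm (\<Sum>n\<in>F - G. c n *\<^sub>R e n))\<^sup>2 = (\<Sum>n\<in>F - G. (c n)\<^sup>2)"
        by (rule norm_sum_e) (use F in auto)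
      also have "\<dots> = (\<Sum>n\<in>F. (c n)\<^sup>2) - (\<Sum>n\<in>G. (c n)\<^sup>2)"
        using F by (simp add: sum_diff)
      also have "\<dots> < (\<epsilon> / 2)\<^sup>2"
        using near[OF F] near[OF G(1) order_refl G(2)]
        unfolding dist_real_def by linarith
      finally have "norm (\<Sum>n\<in>F - G. c n *\<^sub>R e n) < \<epsilon> / 2"
        using power2_less_imp_less[of _ "\<epsilon> / 2"] \<open>\<epsilon> > 0\<close> by simp
      then show ?thesis using F by (simp add: dist_norm sum_diff)
    qed
    have "eventually (\<lambda>F. finite F \<and> G \<subseteq> F \<and> F \<subseteq> {1..}) ?at"
      unfolding eventually_finite_subsets_at_top using G by metis
    moreover have "dist (\<Sum>n\<in>F. c n *\<^sub>R e n) (\<Sum>n\<in>F'. c n *\<^sub>R e n) < \<epsilon>"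
      if "finite F \<and> G \<subseteq> F \<and> F \<subseteq> {1..}" "finite F' \<and> G \<subseteq> F' \<and> F' \<subseteq> {1..}" for F F'
      by (rule dist_triangle_half_l[of _ "\<Sum>n\<in>G. c n *\<^sub>R e n"]) (use that half in simp_all)
    ultimately show ?thesis
      by (intro exI[of _ "\<lambda>F. finite F \<and> G \<subseteq> F \<and> F \<subseteq> {1..}"] conjI) simp_all
  qed
  have "cauchy_filter (filtermap (sum (\<lambda>n. c n *\<^sub>R e n)) ?at)"
    unfolding cauchy_filter_metric_filtermap using cauchy by blast
  moreover have "complete (UNIV :: 'a set)"
    by (meson Cauchy_convergent UNIV_I complete_def convergent_def)
  ultimately obtain L where "(sum (\<lambda>n. c n *\<^sub>R e n) \<longlongrightarrow> L) ?at"
    using cauchy_filter_complete_converges[of "filtermap (sum (\<lambda>n. c n *\<^sub>R e n)) ?at" UNIV]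
    by (auto simp: filterlim_def filtermap_bot_iff)
  then show ?thesis unfolding summable_on_def has_sum_def by (rule exI)
qed

lemma A_inner_e: "u \<in> D \<Longrightarrow> n \<ge> 1 \<Longrightarrow> A u \<bullet> e n = lam n * (u \<bullet> e n)"
  using A_sym e_dom A_e by simp

lemma lam_powr_1: "n \<ge> 1 \<Longrightarrow> lam n powr 1 = lam n"
  using lam_pos[of n] by simp

lemma pow_op_1:
  assumes "u \<in> D"
  shows "pow_op lam e 1 u = A u"
proof -
  have "((\<lambda>n. (lam n powr 1 * (u \<bullet> e n)) *\<^sub>R e n) has_sum A u) {1..}"
    using fourier_has_sum[of "A u"]
    by (rule has_sum_cong[THEN iffD1, rotated]) (simp only: atLeast_iff A_inner_e[OF assms] lam_powr_1)
  then show ?thesis unfolding pow_op_def by (rule infsumI)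
qed

lemma pow_dom_1: "pow_dom lam e 1 = D"
proof (intro equalityI subsetI)
  fix u assume u: "u \<in> D"
  have "((\<lambda>n. A u \<bullet> ((A u \<bullet> e n) *\<^sub>R e n)) has_sum A u \<bullet> A u) {1..}"
    by (rule has_sum_bounded_linear[OF bounded_linear_inner_right fourier_has_sum])
  then have "((\<lambda>n. (lam n powr 1 * (u \<bullet> e n))\<^sup>2) has_sum A u \<bullet> A u) {1..}"
    by (rule has_sum_cong[THEN iffD1, rotated])
      (simp only: atLeast_iff A_inner_e[OF u] lam_powr_1 inner_scaleR_right power2_eq_square)
  then show "u \<in> pow_dom lam e 1" unfolding pow_dom_def summable_on_def by blast
next
  fix u assume "u \<in> pow_dom lam e 1"
  then obtain w where w: "((\<lambda>n. (lam n powr 1 * (u \<bullet> e n)) *\<^sub>R e n) has_sum w) {1..}"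
    using riesz_fischer[of "\<lambda>n. lam n powr 1 * (u \<bullet> e n)"] has_sum_infsum
    unfolding pow_dom_def by blast
  have "A \<phi> \<bullet> u = \<phi> \<bullet> w" if \<phi>: "\<phi> \<in> D" for \<phi>
  proof (rule has_sum_unique)
    show "((\<lambda>n. \<phi> \<bullet> ((lam n powr 1 * (u \<bullet> e n)) *\<^sub>R e n)) has_sum \<phi> \<bullet> w) {1..}"
      by (rule has_sum_bounded_linear[OF bounded_linear_inner_right w])
    have "((\<lambda>n. A \<phi> \<bullet> ((u \<bullet> e n) *\<^sub>R e n)) has_sum A \<phi> \<bullet> u) {1..}"
      by (rule has_sum_bounded_linear[OF bounded_linear_inner_right fourier_has_sum])
    then show "((\<lambda>n. \<phi> \<bullet> ((lam n powr 1 * (u \<bullet> e n)) *\<^sub>R e n)) has_sum A \<phi> \<bullet> u) {1..}"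
      by (rule has_sum_cong[THEN iffD1, rotated]) (simp only: atLeast_iff A_inner_e[OF \<phi>] lam_powr_1 inner_scaleR_right mult_ac)
  qed
  then show "u \<in> D" using selfadjoint unfolding selfadjoint_op_def by blast
qed

corollary H_space_2: "H_space lam e 2 = D"
  by (simp add: H_space_def pow_dom_1)

corollary H_inner_2: "u \<in> D \<Longrightarrow> v \<in> D \<Longrightarrow> H_inner lam e 2 u v = A u \<bullet> A v"
  by (simp add: H_inner_def pow_op_1)

end

end

theory Submission
  imports Defs
begin

text \<open>Equal energies give both equations the same coefficient \<open>C\<close>. On a mode with eigenvalue
  \<open>\<lambda>\<close> and amplitudes \<open>a, b \<noteq> 0\<close>, sum and difference of the two equations decouple into
  \<open>\<lambda> (\<lambda> + C) (a + b) = 0\<close> and \<open>(\<lambda>\<^sup>2 + C \<lambda> + 2 k) (a - b) = 0\<close>. So either \<open>b = a\<close> and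
  \<open>\<lambda> = - C\<close>, or \<open>b = - a\<close> and \<open>\<lambda> (- C - \<lambda>) = 2 k\<close>. The first alternative holds for at most one
  mode, the second for at most two, and it forces \<open>\<lambda> < - C\<close>: among three modes the one
  with the largest eigenvalue is of the first kind, the others are of the second. The energy
  identity defining \<open>C\<close> then is the equation of an ellipsoid, which has real points exactly
  if \<open>\<lambda>\<^bsub>n\<^sub>3\<^esub> < - \<beta>\<close>.\<close>

section \<open>Scalar equations for one mode and for three modes\<close>

lemma mode_equations_iff:
  fixes L C k a b :: real
  assumes "L > 0" "k > 0" "a \<noteq> 0" "b \<noteq> 0"
  shows "L\<^sup>2 * a + C * L * a + k * (a - b) = 0 \<and> L\<^sup>2 * b + C * L * b - k * (a - b) = 0 \<longleftrightarrow>
    b = a \<and> L = - C \<or> b = - a \<and> L * (- C - L) = 2 * k" (is "?E1 \<and> ?E2 \<longleftrightarrow> ?R")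
proof
  assume E: "?E1 \<and> ?E2"
  then have "L * ((L + C) * (a + b)) = 0" by algebra
  with assms have "L = - C \<or> b = - a" by auto
  \<comment> \<open>For \<open>L = - C\<close> the first two terms of \<open>?E1\<close> cancel and
    only the coupling term is left; \<open>k > 0\<close> then forces \<open>a = b\<close>.\<close>
  moreover have "k * (a - b) = 0" if "L = - C"
    using E that by algebra
  moreover have "a * (L * (- C - L) - 2 * k) = 0" if "b = - a"
    using E that by algebra
  ultimately show ?R using assms by auto
next
  assume ?R
  then show "?E1 \<and> ?E2"
  proof
    assume "b = a \<and> L = - C"
    then show ?thesis by (simp add: power2_eq_square)
  next
    assume "b = - a \<and> L * (- C - L) = 2 * k"
    then have "b = - a" "L * (- C - L) = 2 * k" by auto
    then show ?thesis by algebra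
  qed
qed

text \<open>A value of the second kind lies below \<open>- C\<close>. If \<open>l3\<close> were of
  that kind, \<open>l1\<close> and \<open>l2\<close> would be below \<open>- C\<close> as well,
  hence of the same kind; but the quadratic equation \<open>l * (- C - l) = 2 * k\<close> has at
  most two roots.\<close>

lemma largest_of_three_modes:
  fixes l1 l2 l3 C k :: real
  assumes "0 < l1" "l1 < l2" "l2 < l3" "k > 0"
    and 1: "l1 = - C \<or> l1 * (- C - l1) = 2 * k"
    and 2: "l2 = - C \<or> l2 * (- C - l2) = 2 * k"
    and 3: "l3 = - C \<or> l3 * (- C - l3) = 2 * k"
  shows "l3 = - C"
proof (rule ccontr)
  have below: "l < - C" if "l * (- C - l) = 2 * k" "l > 0" for l
    using that assms(4) zero_less_mult_pos[of l "- C - l"] by simp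
  assume "l3 \<noteq> - C"
  with 3 have e3: "l3 * (- C - l3) = 2 * k" by simp
  with below[of l3] assms 1 2
  have e1: "l1 * (- C - l1) = 2 * k" and e2: "l2 * (- C - l2) = 2 * k" by auto
  \<comment> \<open>Subtracting two instances of the quadratic equation splits off the difference of
    the roots. Distinct roots add up to \<open>- C\<close>, so \<open>l1\<close> and
    \<open>l2\<close> would both equal \<open>- C - l3\<close>.\<close>
  have "(l2 - l3) * (C + l2 + l3) = 0" "(l1 - l3) * (C + l1 + l3) = 0"
    using e1 e2 e3 by algebra+
  with assms show False by auto
qed

section \<open>Reordering the three indices\<close>

text \<open>The amplitudes are functions of the index and the sums range over the set of indices, so
  only this set matters.\<close>

lemma trimodal_perm:
  assumes "{m\<^sub>1, m\<^sub>2, m\<^sub>3} = {n\<^sub>1, n\<^sub>2, n\<^sub>3}"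
    and "distinct [n\<^sub>1, n\<^sub>2, n\<^sub>3]"
    and "trimodal e m\<^sub>1 m\<^sub>2 m\<^sub>3 u v"
  shows "trimodal e n\<^sub>1 n\<^sub>2 n\<^sub>3 u v"
proof -
  have "\<forall>n\<in>{m\<^sub>1, m\<^sub>2, m\<^sub>3}. n \<ge> 1" using assms(3) by (simp add: trimodal_def)
  then have "\<forall>n\<in>{n\<^sub>1, n\<^sub>2, n\<^sub>3}. n \<ge> 1" by (simp only: assms(1))
  moreover have "\<exists>\<alpha> \<gamma> :: nat \<Rightarrow> real.
        (\<forall>n \<in> {m\<^sub>1, m\<^sub>2, m\<^sub>3}. \<alpha> n \<noteq> 0 \<and> \<gamma> n \<noteq> 0) \<and>
        u = (\<Sum>n \<in> {m\<^sub>1, m\<^sub>2, m\<^sub>3}. \<alpha> n *\<^sub>R e n) \<and>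
        v = (\<Sum>n \<in> {m\<^sub>1, m\<^sub>2, m\<^sub>3}. \<gamma> n *\<^sub>R e n)"
    using assms(3) unfolding trimodal_def by blast
  ultimately show ?thesis
    unfolding trimodal_def assms(1) using assms(2) by simp
qed

text \<open>Solutions may list their modes in any order, whereas the triples in \<open>T_set\<close>
  are increasing; this bridges the two conventions.\<close>

lemma trimodal_ordered:
  assumes "trimodal e m\<^sub>1 m\<^sub>2 m\<^sub>3 u v"
  obtains n\<^sub>1 n\<^sub>2 n\<^sub>3 where "1 \<le> n\<^sub>1" "n\<^sub>1 < n\<^sub>2" "n\<^sub>2 < n\<^sub>3" "trimodal e n\<^sub>1 n\<^sub>2 n\<^sub>3 u v"
proof -
  have d: "m\<^sub>1 \<noteq> m\<^sub>2" "m\<^sub>1 \<noteq> m\<^sub>3" "m\<^sub>2 \<noteq> m\<^sub>3"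
    using assms by (auto simp: trimodal_def)
  obtain n\<^sub>1 n\<^sub>2 n\<^sub>3 where n: "{m\<^sub>1, m\<^sub>2, m\<^sub>3} = {n\<^sub>1, n\<^sub>2, n\<^sub>3}" "n\<^sub>1 < n\<^sub>2" "n\<^sub>2 < n\<^sub>3"
  proof -
    consider "m\<^sub>1 < m\<^sub>2" "m\<^sub>2 < m\<^sub>3" | "m\<^sub>1 < m\<^sub>3" "m\<^sub>3 < m\<^sub>2" | "m\<^sub>2 < m\<^sub>1" "m\<^sub>1 < m\<^sub>3"
      | "m\<^sub>2 < m\<^sub>3" "m\<^sub>3 < m\<^sub>1" | "m\<^sub>3 < m\<^sub>1" "m\<^sub>1 < m\<^sub>2" | "m\<^sub>3 < m\<^sub>2" "m\<^sub>2 < m\<^sub>1"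
      using d by linarith
    then show ?thesis
    proof cases
      case 1
      then show ?thesis using that[of m\<^sub>1 m\<^sub>2 m\<^sub>3] by auto
    next
      case 2
      then show ?thesis using that[of m\<^sub>1 m\<^sub>3 m\<^sub>2] by auto
    next
      case 3
      then show ?thesis using that[of m\<^sub>2 m\<^sub>1 m\<^sub>3] by auto
    next
      case 4
      then show ?thesis using that[of m\<^sub>2 m\<^sub>3 m\<^sub>1] by auto
    next
      case 5
      then show ?thesis using that[of m\<^sub>3 m\<^sub>1 m\<^sub>2] by auto
    next
      case 6
      then show ?thesis using that[of m\<^sub>3 m\<^sub>2 m\<^sub>1] by auto
    qed
  qed
  have t: "trimodal e n\<^sub>1 n\<^sub>2 n\<^sub>3 u v"
    using trimodal_perm[OF n(1) _ assms] n(2,3) by auto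
  then have "1 \<le> n\<^sub>1" by (simp add: trimodal_def)
  from that[OF this n(2,3) t] show thesis .
qed

section \<open>The square root of the operator, and finite sums of eigenvectors\<close>

context simple_spectrum_operator
begin

lemma lam_less: "1 \<le> m \<Longrightarrow> m < n \<Longrightarrow> lam m < lam n"
  using lam_strict_mono by (simp add: strict_mono_on_def)

lemma subspace_D: "subspace D"
  using selfadjoint by (simp add: selfadjoint_op_def linear_on_dom_def)

lemma sum_e_dom: "F \<subseteq> {1..} \<Longrightarrow> (\<Sum>n\<in>F. c n *\<^sub>R e n) \<in> D"
  by (intro subspace_sum subspace_D subspace_scale e_dom) auto

lemma parseval: "((\<lambda>n. (u \<bullet> e n) * (w \<bullet> e n)) has_sum u \<bullet> w) {1..}"
  using has_sum_bounded_linear[OF bounded_linear_inner_right fourier_has_sum, of u w]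
  by (simp add: mult.commute)

text \<open>Pairing with \<open>e m\<close> is continuous, so it passes through the infinite sum,
  and orthonormality leaves only the term \<open>m\<close>. This gives access to the Fourier
  coefficients of \<open>pow_op\<close>.\<close>

lemma inner_infsum_e:
  assumes "(\<lambda>n. (c n)\<^sup>2) summable_on {1..}" "m \<ge> 1"
  shows "(\<Sum>\<^sub>\<infinity>n\<in>{1..}. c n *\<^sub>R e n) \<bullet> e m = c m"
proof (rule has_sum_unique)
  show "((\<lambda>n. (c n *\<^sub>R e n) \<bullet> e m) has_sum (\<Sum>\<^sub>\<infinity>n\<in>{1..}. c n *\<^sub>R e n) \<bullet> e m) {1..}"
    by (rule has_sum_bounded_linear[OF bounded_linear_inner_left
          has_sum_infsum[OF riesz_fischer[OF assms(1)]]])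
  show "((\<lambda>n. (c n *\<^sub>R e n) \<bullet> e m) has_sum c m) {1..}"
    by (rule has_sum_finite_neutralI[of "{m}"]) (use assms(2) orthonormal in auto)
qed

lemma sqrt_lam: "n \<ge> 1 \<Longrightarrow> lam n powr (1 / 2) * lam n powr (1 / 2) = lam n"
  using lam_pos[of n] by (simp flip: powr_add)

lemma inner_pow_op_half:
  assumes "u \<in> D" "m \<ge> 1"
  shows "pow_op lam e (1 / 2) u \<bullet> e m = lam m powr (1 / 2) * (u \<bullet> e m)"
proof -
  \<comment> \<open>An infinite sum that does not converge is 0 by default, so square summability
    comes first: by Parseval the squares add up to \<open>A u \<bullet> u\<close>.\<close>
  have "((\<lambda>n. (lam n powr (1 / 2) * (u \<bullet> e n))\<^sup>2) has_sum A u \<bullet> u) {1..}"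
  proof (rule has_sum_cong[THEN iffD1, OF _ parseval])
    fix n :: nat assume "n \<in> {1..}"
    then have "n \<ge> 1" by simp
    have "(lam n powr (1 / 2) * (u \<bullet> e n))\<^sup>2
      = (lam n powr (1 / 2) * lam n powr (1 / 2)) * (u \<bullet> e n) * (u \<bullet> e n)"
      by (simp add: power2_eq_square mult_ac)
    then show "(A u \<bullet> e n) * (u \<bullet> e n) = (lam n powr (1 / 2) * (u \<bullet> e n))\<^sup>2"
      by (simp only: sqrt_lam[OF \<open>n \<ge> 1\<close>] A_inner_e[OF assms(1) \<open>n \<ge> 1\<close>])
  qed
  then have "(\<lambda>n. (lam n powr (1 / 2) * (u \<bullet> e n))\<^sup>2) summable_on {1..}"
    by (rule has_sum_imp_summable)
  from inner_infsum_e[OF this assms(2)] show ?thesis by (simp add: pow_op_def)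
qed

text \<open>Both sides have the same Parseval series, because two factors
  \<open>lam n powr (1 / 2)\<close> multiply to \<open>lam n\<close>. Computations with the form of
  order 1 can then be done with \<open>A\<close> alone.\<close>

lemma H_inner_1:
  assumes "u \<in> D" "w \<in> D"
  shows "H_inner lam e 1 u w = A u \<bullet> w"
proof (rule has_sum_unique)
  show "((\<lambda>n. (A u \<bullet> e n) * (w \<bullet> e n)) has_sum A u \<bullet> w) {1..}" by (rule parseval)
  show "((\<lambda>n. (A u \<bullet> e n) * (w \<bullet> e n)) has_sum H_inner lam e 1 u w) {1..}"
    unfolding H_inner_def
  proof (rule has_sum_cong[THEN iffD1, OF _ parseval])
    fix n :: nat assume "n \<in> {1..}"
    then have n: "n \<ge> 1" by simp
    have "(pow_op lam e (1 / 2) u \<bullet> e n) * (pow_op lam e (1 / 2) w \<bullet> e n)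
      = (lam n powr (1 / 2) * lam n powr (1 / 2)) * (u \<bullet> e n) * (w \<bullet> e n)"
      by (simp only: inner_pow_op_half[OF assms(1) n] inner_pow_op_half[OF assms(2) n] mult_ac)
    then show "(pow_op lam e (1 / 2) u \<bullet> e n) * (pow_op lam e (1 / 2) w \<bullet> e n)
      = (A u \<bullet> e n) * (w \<bullet> e n)"
      by (simp only: sqrt_lam[OF n] A_inner_e[OF assms(1) n])
  qed
qed

lemma sum_e_inner_A:
  assumes "F \<subseteq> {1..}" "w \<in> D"
  shows "(\<Sum>n\<in>F. c n *\<^sub>R e n) \<bullet> A w = (\<Sum>n\<in>F. (lam n * c n) *\<^sub>R e n) \<bullet> w"
  unfolding inner_sum_left
proof (rule sum.cong[OF refl])
  fix n assume "n \<in> F"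
  then have "n \<ge> 1" using assms(1) by auto
  then show "(c n *\<^sub>R e n) \<bullet> A w = ((lam n * c n) *\<^sub>R e n) \<bullet> w"
    using A_inner_e[OF assms(2), of n] by (simp add: inner_commute)
qed

text \<open>By \<open>sum_e_inner_A\<close>, the sum and its claimed image form a pair in the graph
  of the adjoint, which by selfadjointness is the graph of \<open>A\<close>.\<close>

lemma A_sum_e:
  assumes "F \<subseteq> {1..}"
  shows "A (\<Sum>n\<in>F. c n *\<^sub>R e n) = (\<Sum>n\<in>F. (lam n * c n) *\<^sub>R e n)"
proof -
  have "A w \<bullet> (\<Sum>n\<in>F. c n *\<^sub>R e n) = w \<bullet> (\<Sum>n\<in>F. (lam n * c n) *\<^sub>R e n)" if "w \<in> D" for w
    using sum_e_inner_A[OF assms that, of c] by (simp add: inner_commute)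
  then have "(\<Sum>n\<in>F. (lam n * c n) *\<^sub>R e n) = A (\<Sum>n\<in>F. c n *\<^sub>R e n)"
    using selfadjoint unfolding selfadjoint_op_def by blast
  then show ?thesis by (rule sym)
qed

text \<open>The squared norm is \<open>u \<bullet> A u\<close> by \<open>H_inner_1\<close>, and
  orthonormality leaves the diagonal terms.\<close>

lemma H_norm_1_sum:
  assumes "finite F" "F \<subseteq> {1..}"
  shows "(H_norm lam e 1 (\<Sum>n\<in>F. c n *\<^sub>R e n))\<^sup>2 = (\<Sum>n\<in>F. lam n * (c n)\<^sup>2)"
proof -
  let ?u = "\<Sum>n\<in>F. c n *\<^sub>R e n"
  have "(H_norm lam e 1 ?u)\<^sup>2 = ?u \<bullet> A ?u"
    using H_inner_1[OF sum_e_dom sum_e_dom, OF assms(2) assms(2), of c c]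
    by (simp add: H_norm_def H_inner_def power2_norm_eq_inner inner_commute)
  also have "\<dots> = (\<Sum>n\<in>F. lam n * c n * (?u \<bullet> e n))"
    unfolding A_sum_e[OF assms(2)] inner_sum_right by simp
  also have "\<dots> = (\<Sum>n\<in>F. lam n * (c n)\<^sup>2)"
  proof (rule sum.cong[OF refl])
    fix n assume n: "n \<in> F"
    then have "n \<ge> 1" using assms(2) by auto
    then show "lam n * c n * (?u \<bullet> e n) = lam n * (c n)\<^sup>2"
      using sum_inner_e[OF assms, of n c] n by (simp add: power2_eq_square)
  qed
  finally show ?thesis .
qed

text \<open>Each \<open>e n\<close> is itself an admissible test function and picks out the
  coefficient \<open>c n\<close>. This turns a variational identity into one scalar equation per
  mode.\<close>

lemma sum_e_orthogonal_dom_iff: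
  assumes "finite F" "F \<subseteq> {1..}"
  shows "(\<forall>\<phi>\<in>D. (\<Sum>n\<in>F. c n *\<^sub>R e n) \<bullet> \<phi> = 0) \<longleftrightarrow> (\<forall>n\<in>F. c n = 0)"
proof
  assume H: "\<forall>\<phi>\<in>D. (\<Sum>n\<in>F. c n *\<^sub>R e n) \<bullet> \<phi> = 0"
  show "\<forall>n\<in>F. c n = 0"
  proof
    fix n assume n: "n \<in> F"
    then have "n \<ge> 1" using assms(2) by auto
    with H e_dom have "(\<Sum>n\<in>F. c n *\<^sub>R e n) \<bullet> e n = 0" by blast
    with n show "c n = 0" using sum_inner_e[OF assms \<open>n \<ge> 1\<close>, of c] by simp
  qed
qed simp

section \<open>The weak formulation, mode by mode\<close>

lemma weak_solution_sum_iff: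
  fixes \<alpha> \<gamma> :: "nat \<Rightarrow> real"
  assumes F: "finite F" "F \<subseteq> {1..}"
    and u: "u = (\<Sum>n\<in>F. \<alpha> n *\<^sub>R e n)" and v: "v = (\<Sum>n\<in>F. \<gamma> n *\<^sub>R e n)"
  shows "weak_solution lam e \<beta> \<rho> k u v \<longleftrightarrow>
    (\<forall>n\<in>F. (lam n)\<^sup>2 * \<alpha> n + C_coeff lam e \<beta> \<rho> u * lam n * \<alpha> n + k * (\<alpha> n - \<gamma> n) = 0 \<and>
           (lam n)\<^sup>2 * \<gamma> n + C_coeff lam e \<beta> \<rho> v * lam n * \<gamma> n - k * (\<alpha> n - \<gamma> n) = 0)"
proof -
  have D: "u \<in> D" "v \<in> D" unfolding u v by (intro sum_e_dom F)+
  \<comment> \<open>One formula serves both equations: \<open>w = u\<close> with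
    \<open>s = k\<close>, and \<open>w = v\<close> with \<open>s = - k\<close>.\<close>
  have form: "H_inner lam e 2 w \<phi> + C * H_inner lam e 1 w \<phi> + s * ((u - v) \<bullet> \<phi>)
      = (\<Sum>n\<in>F. ((lam n)\<^sup>2 * c n + C * lam n * c n + s * (\<alpha> n - \<gamma> n)) *\<^sub>R e n) \<bullet> \<phi>"
    if "w = (\<Sum>n\<in>F. c n *\<^sub>R e n)" "\<phi> \<in> D" for w \<phi> c C s
  proof -
    have wD: "w \<in> D" unfolding that(1) by (intro sum_e_dom F)
    \<comment> \<open>Of the two operators in \<open>A w \<bullet> A \<phi>\<close>, the first is
      evaluated on the finite sum and the second is moved over from the test function.\<close>
    have "H_inner lam e 2 w \<phi> = (\<Sum>n\<in>F. (lam n * (lam n * c n)) *\<^sub>R e n) \<bullet> \<phi>"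
      unfolding H_inner_2[OF wD that(2)] unfolding that(1) A_sum_e[OF F(2)]
      by (rule sum_e_inner_A[OF F(2) that(2)])
    moreover have "H_inner lam e 1 w \<phi> = (\<Sum>n\<in>F. (lam n * c n) *\<^sub>R e n) \<bullet> \<phi>"
      unfolding H_inner_1[OF wD that(2)] unfolding that(1) A_sum_e[OF F(2)] ..
    moreover have "(\<Sum>n\<in>F. ((lam n)\<^sup>2 * c n + C * lam n * c n + s * (\<alpha> n - \<gamma> n)) *\<^sub>R e n)
      = (\<Sum>n\<in>F. (lam n * (lam n * c n)) *\<^sub>R e n) + C *\<^sub>R (\<Sum>n\<in>F. (lam n * c n) *\<^sub>R e n) + s *\<^sub>R (u - v)"
      unfolding u v scaleR_sum_right sum_subtractf[symmetric] sum.distrib[symmetric]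
      by (rule sum.cong[OF refl]) (simp add: algebra_simps power2_eq_square)
    ultimately show ?thesis by (simp add: inner_add_left)
  qed
  \<comment> \<open>The definition quantifies over both test functions jointly; since the domain is
    nonempty, the two equations can be separated.\<close>
  have zero: "0 \<in> D" using subspace_D by (rule subspace_0)
  have "weak_solution lam e \<beta> \<rho> k u v \<longleftrightarrow>
    (\<forall>\<phi>\<in>D. H_inner lam e 2 u \<phi> + C_coeff lam e \<beta> \<rho> u * H_inner lam e 1 u \<phi> + k * ((u - v) \<bullet> \<phi>) = 0) \<and>
    (\<forall>\<phi>\<in>D. H_inner lam e 2 v \<phi> + C_coeff lam e \<beta> \<rho> v * H_inner lam e 1 v \<phi> + (- k) * ((u - v) \<bullet> \<phi>) = 0)"
    unfolding weak_solution_def H_space_2 using D zero by auto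
  also have "\<dots> \<longleftrightarrow>
    (\<forall>\<phi>\<in>D. (\<Sum>n\<in>F. ((lam n)\<^sup>2 * \<alpha> n + C_coeff lam e \<beta> \<rho> u * lam n * \<alpha> n + k * (\<alpha> n - \<gamma> n)) *\<^sub>R e n) \<bullet> \<phi> = 0) \<and>
    (\<forall>\<phi>\<in>D. (\<Sum>n\<in>F. ((lam n)\<^sup>2 * \<gamma> n + C_coeff lam e \<beta> \<rho> v * lam n * \<gamma> n + (- k) * (\<alpha> n - \<gamma> n)) *\<^sub>R e n) \<bullet> \<phi> = 0)"
    by (simp only: form[OF u] form[OF v] cong: ball_cong)
  also have "\<dots> \<longleftrightarrow>
    (\<forall>n\<in>F. (lam n)\<^sup>2 * \<alpha> n + C_coeff lam e \<beta> \<rho> u * lam n * \<alpha> n + k * (\<alpha> n - \<gamma> n) = 0) \<and>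
    (\<forall>n\<in>F. (lam n)\<^sup>2 * \<gamma> n + C_coeff lam e \<beta> \<rho> v * lam n * \<gamma> n + (- k) * (\<alpha> n - \<gamma> n) = 0)"
    by (simp only: sum_e_orthogonal_dom_iff[OF F])
  finally show ?thesis by (simp add: ball_conj_distrib)
qed

text \<open>Equal energies give both equations the same coefficient, so
  \<open>mode_equations_iff\<close> applies to every mode, and \<open>largest_of_three_modes\<close>
  decides which alternative holds where.\<close>

lemma weak_solution_trimodal_iff:
  fixes \<alpha> \<gamma> :: "nat \<Rightarrow> real" and k :: real
  assumes n: "1 \<le> n\<^sub>1" "n\<^sub>1 < n\<^sub>2" "n\<^sub>2 < n\<^sub>3" and k: "k > 0"
    and nz: "\<forall>n\<in>{n\<^sub>1, n\<^sub>2, n\<^sub>3}. \<alpha> n \<noteq> 0 \<and> \<gamma> n \<noteq> 0"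
    and u: "u = (\<Sum>n\<in>{n\<^sub>1, n\<^sub>2, n\<^sub>3}. \<alpha> n *\<^sub>R e n)" and v: "v = (\<Sum>n\<in>{n\<^sub>1, n\<^sub>2, n\<^sub>3}. \<gamma> n *\<^sub>R e n)"
    and eq: "H_norm lam e 1 u = H_norm lam e 1 v"
  shows "weak_solution lam e \<beta> \<rho> k u v \<longleftrightarrow>
    \<gamma> n\<^sub>1 = - \<alpha> n\<^sub>1 \<and> \<gamma> n\<^sub>2 = - \<alpha> n\<^sub>2 \<and> \<gamma> n\<^sub>3 = \<alpha> n\<^sub>3 \<and> lam n\<^sub>3 = - C_coeff lam e \<beta> \<rho> u \<and>
    lam n\<^sub>1 * (lam n\<^sub>3 - lam n\<^sub>1) = 2 * k \<and> lam n\<^sub>2 * (lam n\<^sub>3 - lam n\<^sub>2) = 2 * k"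
proof -
  define C where "C = C_coeff lam e \<beta> \<rho> u"
  have Cv: "C_coeff lam e \<beta> \<rho> v = C" by (simp add: C_def C_coeff_def eq)
  let ?F = "{n\<^sub>1, n\<^sub>2, n\<^sub>3}"
  have F: "finite ?F" "?F \<subseteq> {1..}" using n by auto
  have l: "0 < lam n\<^sub>1" "lam n\<^sub>1 < lam n\<^sub>2" "lam n\<^sub>2 < lam n\<^sub>3"
    using n lam_pos lam_less by auto
  have "weak_solution lam e \<beta> \<rho> k u v \<longleftrightarrow> (\<forall>n\<in>?F.
      \<gamma> n = \<alpha> n \<and> lam n = - C \<or> \<gamma> n = - \<alpha> n \<and> lam n * (- C - lam n) = 2 * k)"
    unfolding weak_solution_sum_iff[OF F u v] C_def[symmetric] Cv
  proof (rule ball_cong[OF refl])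
    fix n assume "n \<in> ?F"
    then have "lam n > 0" "\<alpha> n \<noteq> 0" "\<gamma> n \<noteq> 0" using l nz by auto
    with k show "((lam n)\<^sup>2 * \<alpha> n + C * lam n * \<alpha> n + k * (\<alpha> n - \<gamma> n) = 0 \<and>
        (lam n)\<^sup>2 * \<gamma> n + C * lam n * \<gamma> n - k * (\<alpha> n - \<gamma> n) = 0) =
      (\<gamma> n = \<alpha> n \<and> lam n = - C \<or> \<gamma> n = - \<alpha> n \<and> lam n * (- C - lam n) = 2 * k)"
      by (intro mode_equations_iff)
  qed
  also have "\<dots> \<longleftrightarrow> \<gamma> n\<^sub>1 = - \<alpha> n\<^sub>1 \<and> \<gamma> n\<^sub>2 = - \<alpha> n\<^sub>2 \<and> \<gamma> n\<^sub>3 = \<alpha> n\<^sub>3 \<and> lam n\<^sub>3 = - C \<and>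
    lam n\<^sub>1 * (lam n\<^sub>3 - lam n\<^sub>1) = 2 * k \<and> lam n\<^sub>2 * (lam n\<^sub>3 - lam n\<^sub>2) = 2 * k" (is "?L \<longleftrightarrow> ?R")
  proof
    assume L: ?L
    then have 3: "lam n\<^sub>3 = - C"
      by (intro largest_of_three_modes[OF l k]) auto
    \<comment> \<open>Strict monotonicity excludes the first alternative for the two lower modes;
      for the top mode the second one would read \<open>0 = 2 * k\<close>.\<close>
    then have "lam n\<^sub>1 \<noteq> - C" "lam n\<^sub>2 \<noteq> - C" "lam n\<^sub>3 * (- C - lam n\<^sub>3) \<noteq> 2 * k" using l k by auto
    with L 3 show ?R by auto
  qed auto
  finally show ?thesis by (simp add: C_def)
qed

section \<open>Trimodal equidistributed solutions as points of an ellipsoid\<close>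

text \<open>Once the signs of the amplitudes are settled, the remaining condition
  \<open>lam n\<^sub>3 = - C_coeff lam e \<beta> \<rho> u\<close> becomes the ellipsoid equation
  when the energy of \<open>u\<close> is written out.\<close>

lemma trimodal_EE_iff:
  fixes \<beta> \<rho> k :: real
  assumes n: "1 \<le> n\<^sub>1" "n\<^sub>1 < n\<^sub>2" "n\<^sub>2 < n\<^sub>3" and \<rho>: "\<rho> > 0" and k: "k > 0"
  shows "(u, v) \<in> trimodal_EE lam e \<beta> \<rho> k n\<^sub>1 n\<^sub>2 n\<^sub>3 \<longleftrightarrow>
    (n\<^sub>1, n\<^sub>2, n\<^sub>3) \<in> T_set lam \<beta> k \<and>
    (\<exists>x y z. u = x *\<^sub>R e n\<^sub>1 + y *\<^sub>R e n\<^sub>2 + z *\<^sub>R e n\<^sub>3 \<and>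
       v = - x *\<^sub>R e n\<^sub>1 - y *\<^sub>R e n\<^sub>2 + z *\<^sub>R e n\<^sub>3 \<and>
       \<rho> * x\<^sup>2 * lam n\<^sub>1 + \<rho> * y\<^sup>2 * lam n\<^sub>2 + \<rho> * z\<^sup>2 * lam n\<^sub>3 + lam n\<^sub>3 + \<beta> = 0 \<and> x * y * z \<noteq> 0)"
    (is "_ \<longleftrightarrow> ?R")
proof -
  let ?F = "{n\<^sub>1, n\<^sub>2, n\<^sub>3}"
  have F: "finite ?F" "?F \<subseteq> {1..}" using n by auto
  have l: "0 < lam n\<^sub>1" "0 < lam n\<^sub>2" "0 < lam n\<^sub>3" using n lam_pos by auto
  have sumF: "(\<Sum>n\<in>?F. g n) = g n\<^sub>1 + g n\<^sub>2 + g n\<^sub>3" for g :: "nat \<Rightarrow> 'b::comm_monoid_add"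
    using n by (simp add: add.assoc)
  have energy: "(H_norm lam e 1 (\<Sum>n\<in>?F. c n *\<^sub>R e n))\<^sup>2
      = lam n\<^sub>1 * (c n\<^sub>1)\<^sup>2 + lam n\<^sub>2 * (c n\<^sub>2)\<^sup>2 + lam n\<^sub>3 * (c n\<^sub>3)\<^sup>2" for c
    unfolding H_norm_1_sum[OF F] by (rule sumF)
  show ?thesis
  proof
    assume "(u, v) \<in> trimodal_EE lam e \<beta> \<rho> k n\<^sub>1 n\<^sub>2 n\<^sub>3"
    then have sol: "weak_solution lam e \<beta> \<rho> k u v" "H_norm lam e 1 u = H_norm lam e 1 v"
      and tri: "trimodal e n\<^sub>1 n\<^sub>2 n\<^sub>3 u v"
      by (auto simp: trimodal_EE_def equidistributed_solution_def)
    then obtain \<alpha> \<gamma> :: "nat \<Rightarrow> real" where nz: "\<forall>n\<in>?F. \<alpha> n \<noteq> 0 \<and> \<gamma> n \<noteq> 0"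
      and u: "u = (\<Sum>n\<in>?F. \<alpha> n *\<^sub>R e n)" and v: "v = (\<Sum>n\<in>?F. \<gamma> n *\<^sub>R e n)"
      unfolding trimodal_def by blast
    have modes: "\<gamma> n\<^sub>1 = - \<alpha> n\<^sub>1" "\<gamma> n\<^sub>2 = - \<alpha> n\<^sub>2" "\<gamma> n\<^sub>3 = \<alpha> n\<^sub>3"
      and C: "lam n\<^sub>3 = - C_coeff lam e \<beta> \<rho> u"
      and T: "lam n\<^sub>1 * (lam n\<^sub>3 - lam n\<^sub>1) = 2 * k" "lam n\<^sub>2 * (lam n\<^sub>3 - lam n\<^sub>2) = 2 * k"
      using sol(1) unfolding weak_solution_trimodal_iff[OF n k nz u v sol(2)] by auto
    define E where "E = (H_norm lam e 1 u)\<^sup>2"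
    have E: "E = lam n\<^sub>1 * (\<alpha> n\<^sub>1)\<^sup>2 + lam n\<^sub>2 * (\<alpha> n\<^sub>2)\<^sup>2 + lam n\<^sub>3 * (\<alpha> n\<^sub>3)\<^sup>2"
      unfolding E_def u by (rule energy)
    have CE: "lam n\<^sub>3 = - \<beta> - \<rho> * E" using C by (simp add: C_coeff_def E_def)
    \<comment> \<open>The energy is strictly positive, which yields the bound
      \<open>lam n\<^sub>3 < - \<beta>\<close> required by \<open>T_set\<close>.\<close>
    have "E > 0" unfolding E using l nz by (intro add_pos_pos mult_pos_pos) auto
    then have "\<rho> * E > 0" using \<rho> by simp
    then have "(n\<^sub>1, n\<^sub>2, n\<^sub>3) \<in> T_set lam \<beta> k"
      using n T CE by (simp add: T_set_def)
    moreover have "u = \<alpha> n\<^sub>1 *\<^sub>R e n\<^sub>1 + \<alpha> n\<^sub>2 *\<^sub>R e n\<^sub>2 + \<alpha> n\<^sub>3 *\<^sub>R e n\<^sub>3"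
      unfolding u by (rule sumF)
    moreover have "v = - \<alpha> n\<^sub>1 *\<^sub>R e n\<^sub>1 - \<alpha> n\<^sub>2 *\<^sub>R e n\<^sub>2 + \<alpha> n\<^sub>3 *\<^sub>R e n\<^sub>3"
      unfolding v sumF modes by simp
    moreover have "\<rho> * (\<alpha> n\<^sub>1)\<^sup>2 * lam n\<^sub>1 + \<rho> * (\<alpha> n\<^sub>2)\<^sup>2 * lam n\<^sub>2 + \<rho> * (\<alpha> n\<^sub>3)\<^sup>2 * lam n\<^sub>3
        + lam n\<^sub>3 + \<beta> = 0"
      using CE E by algebra
    moreover have "\<alpha> n\<^sub>1 * \<alpha> n\<^sub>2 * \<alpha> n\<^sub>3 \<noteq> 0" using nz by simp
    ultimately show ?R by blast
  next
    assume ?R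
    then obtain x y z where T: "(n\<^sub>1, n\<^sub>2, n\<^sub>3) \<in> T_set lam \<beta> k"
      and uxyz: "u = x *\<^sub>R e n\<^sub>1 + y *\<^sub>R e n\<^sub>2 + z *\<^sub>R e n\<^sub>3"
      and vxyz: "v = - x *\<^sub>R e n\<^sub>1 - y *\<^sub>R e n\<^sub>2 + z *\<^sub>R e n\<^sub>3"
      and ell: "\<rho> * x\<^sup>2 * lam n\<^sub>1 + \<rho> * y\<^sup>2 * lam n\<^sub>2 + \<rho> * z\<^sup>2 * lam n\<^sub>3 + lam n\<^sub>3 + \<beta> = 0"
      and nz: "x * y * z \<noteq> 0"
      by blast
    \<comment> \<open>Only the values at the three indices matter; \<open>z\<close> at all other
      indices is an arbitrary default.\<close>
    define \<alpha> \<gamma> where "\<alpha> = (\<lambda>n. if n = n\<^sub>1 then x else if n = n\<^sub>2 then y else z)"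
      and "\<gamma> = (\<lambda>n. if n = n\<^sub>1 then - x else if n = n\<^sub>2 then - y else z)"
    have \<alpha>: "\<alpha> n\<^sub>1 = x" "\<alpha> n\<^sub>2 = y" "\<alpha> n\<^sub>3 = z" and \<gamma>: "\<gamma> n\<^sub>1 = - x" "\<gamma> n\<^sub>2 = - y" "\<gamma> n\<^sub>3 = z"
      using n by (auto simp: \<alpha>_def \<gamma>_def)
    have u: "u = (\<Sum>n\<in>?F. \<alpha> n *\<^sub>R e n)" and v: "v = (\<Sum>n\<in>?F. \<gamma> n *\<^sub>R e n)"
      unfolding sumF \<alpha> \<gamma> uxyz vxyz by simp_all
    have nz': "\<forall>n\<in>?F. \<alpha> n \<noteq> 0 \<and> \<gamma> n \<noteq> 0" using nz by (simp add: \<alpha> \<gamma>)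
    have E: "(H_norm lam e 1 u)\<^sup>2 = lam n\<^sub>1 * x\<^sup>2 + lam n\<^sub>2 * y\<^sup>2 + lam n\<^sub>3 * z\<^sup>2"
      "(H_norm lam e 1 v)\<^sup>2 = lam n\<^sub>1 * x\<^sup>2 + lam n\<^sub>2 * y\<^sup>2 + lam n\<^sub>3 * z\<^sup>2"
      unfolding u v energy \<alpha> \<gamma> by simp_all
    \<comment> \<open>The amplitudes of \<open>u\<close> and \<open>v\<close> differ only in sign,
      which their squares do not see.\<close>
    have eq: "H_norm lam e 1 u = H_norm lam e 1 v"
      by (rule power2_eq_imp_eq) (use E in \<open>simp_all add: H_norm_def\<close>)
    have C: "lam n\<^sub>3 = - C_coeff lam e \<beta> \<rho> u"
      unfolding C_coeff_def E using ell by (simp add: algebra_simps)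
    have weak: "weak_solution lam e \<beta> \<rho> k u v"
      unfolding weak_solution_trimodal_iff[OF n k nz' u v eq]
      using T C by (auto simp: \<alpha> \<gamma> T_set_def)
    have "u \<bullet> e n\<^sub>1 = x" using sum_inner_e[OF F n(1), of \<alpha>] by (simp add: u \<alpha>)
    then have "u \<noteq> 0" using nz by auto
    moreover have "trimodal e n\<^sub>1 n\<^sub>2 n\<^sub>3 u v"
      unfolding trimodal_def using n nz' u v
      by (intro conjI exI[of _ \<alpha>] exI[of _ \<gamma>]) auto
    ultimately show "(u, v) \<in> trimodal_EE lam e \<beta> \<rho> k n\<^sub>1 n\<^sub>2 n\<^sub>3"
      using weak eq by (simp add: trimodal_EE_def equidistributed_solution_def)
  qed
qed

text \<open>A curve on the ellipsoid, parametrized by the share \<open>t\<close> of the energy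
  carried by the first mode, gives a different solution for each \<open>t\<close>.\<close>

lemma infinite_trimodal_EE:
  fixes \<beta> \<rho> k :: real
  assumes T: "(n\<^sub>1, n\<^sub>2, n\<^sub>3) \<in> T_set lam \<beta> k" and \<rho>: "\<rho> > 0" and k: "k > 0"
  shows "infinite (trimodal_EE lam e \<beta> \<rho> k n\<^sub>1 n\<^sub>2 n\<^sub>3)"
proof -
  have n: "1 \<le> n\<^sub>1" "n\<^sub>1 < n\<^sub>2" "n\<^sub>2 < n\<^sub>3" using T by (auto simp: T_set_def)
  have l: "0 < lam n\<^sub>1" "0 < lam n\<^sub>2" "0 < lam n\<^sub>3" using n lam_pos by auto
  \<comment> \<open>\<open>R\<close> is the energy prescribed by the ellipsoid equation; it is
    positive because \<open>lam n\<^sub>3 < - \<beta>\<close>.\<close>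
  define R where "R = (- \<beta> - lam n\<^sub>3) / \<rho>"
  have R: "R > 0" using T \<rho> by (auto simp: R_def T_set_def)
  have R_eq: "\<rho> * R = - \<beta> - lam n\<^sub>3" using \<rho> by (simp add: R_def)
  have ex: "\<exists>u v. (u, v) \<in> trimodal_EE lam e \<beta> \<rho> k n\<^sub>1 n\<^sub>2 n\<^sub>3 \<and> (u \<bullet> e n\<^sub>1)\<^sup>2 = t * R / lam n\<^sub>1"
    if t: "t \<in> {0<..<1/2}" for t
  proof -
    \<comment> \<open>The three modes carry the shares \<open>t\<close>, \<open>t\<close> and
      \<open>1 - 2 * t\<close> of \<open>R\<close>; all are positive for \<open>t\<close> between 0
      and 1/2, so no amplitude vanishes.\<close>
    define x y z where "x = sqrt (t * R / lam n\<^sub>1)" and "y = sqrt (t * R / lam n\<^sub>2)"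
      and "z = sqrt ((1 - 2 * t) * R / lam n\<^sub>3)"
    have pos: "t * R / lam n\<^sub>1 > 0" "t * R / lam n\<^sub>2 > 0" "(1 - 2 * t) * R / lam n\<^sub>3 > 0"
      using t l R by auto
    have sq: "x\<^sup>2 = t * R / lam n\<^sub>1" "y\<^sup>2 = t * R / lam n\<^sub>2" "z\<^sup>2 = (1 - 2 * t) * R / lam n\<^sub>3"
      using pos unfolding x_def y_def z_def by simp_all
    have "x\<^sup>2 * lam n\<^sub>1 = t * R" "y\<^sup>2 * lam n\<^sub>2 = t * R" "z\<^sup>2 * lam n\<^sub>3 = (1 - 2 * t) * R"
      unfolding sq using l by simp_all
    then have ell: "\<rho> * x\<^sup>2 * lam n\<^sub>1 + \<rho> * y\<^sup>2 * lam n\<^sub>2 + \<rho> * z\<^sup>2 * lam n\<^sub>3 + lam n\<^sub>3 + \<beta> = 0"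
      using R_eq by algebra
    have nz: "x * y * z \<noteq> 0" using t l R by (simp add: x_def y_def z_def)
    let ?u = "x *\<^sub>R e n\<^sub>1 + y *\<^sub>R e n\<^sub>2 + z *\<^sub>R e n\<^sub>3"
    let ?v = "- x *\<^sub>R e n\<^sub>1 - y *\<^sub>R e n\<^sub>2 + z *\<^sub>R e n\<^sub>3"
    have "(?u, ?v) \<in> trimodal_EE lam e \<beta> \<rho> k n\<^sub>1 n\<^sub>2 n\<^sub>3"
      unfolding trimodal_EE_iff[OF n \<rho> k] using T ell nz by blast
    moreover have "?u \<bullet> e n\<^sub>1 = x"
      using n by (simp add: inner_add_left orthonormal)
    ultimately show ?thesis using sq(1) by metis
  qed
  \<comment> \<open>\<open>?g\<close> recovers \<open>t\<close> from a solution, so it maps the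
    solution set onto a superset of an interval.\<close>
  let ?g = "\<lambda>p. (fst p \<bullet> e n\<^sub>1)\<^sup>2 * lam n\<^sub>1 / R"
  have "{0<..<1/2} \<subseteq> ?g ` trimodal_EE lam e \<beta> \<rho> k n\<^sub>1 n\<^sub>2 n\<^sub>3"
  proof
    fix t :: real assume "t \<in> {0<..<1/2}"
    then obtain u v where uv: "(u, v) \<in> trimodal_EE lam e \<beta> \<rho> k n\<^sub>1 n\<^sub>2 n\<^sub>3"
      "(u \<bullet> e n\<^sub>1)\<^sup>2 = t * R / lam n\<^sub>1"
      using ex by blast
    then have "?g (u, v) = t" using l R by simp
    then show "t \<in> ?g ` trimodal_EE lam e \<beta> \<rho> k n\<^sub>1 n\<^sub>2 n\<^sub>3"
      by (rule image_eqI[OF sym uv(1)])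
  qed
  moreover have "infinite {0<..<1/2::real}" by (rule infinite_Ioo) simp
  ultimately show ?thesis using finite_surj by blast
qed

end

section \<open>Existence in arbitrary index order, and the dichotomy for increasing triples\<close>

theorem theorem5p5:
  fixes D :: "'a::{real_inner, banach, second_countable_topology} set"
    and A :: "'a \<Rightarrow> 'a"
    and lam :: "nat \<Rightarrow> real"
    and e :: "nat \<Rightarrow> 'a"
    and \<beta> \<rho> k :: real
  assumes op: "simple_spectrum_operator D A lam e"
    and \<rho>: "\<rho> > 0"
    and k: "k > 0"
  shows "((\<exists>n\<^sub>1 n\<^sub>2 n\<^sub>3. trimodal_EE lam e \<beta> \<rho> k n\<^sub>1 n\<^sub>2 n\<^sub>3 \<noteq> {}) \<longleftrightarrow> T_set lam \<beta> k \<noteq> {}) \<and>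
    (\<forall>n\<^sub>1 n\<^sub>2 n\<^sub>3. 1 \<le> n\<^sub>1 \<and> n\<^sub>1 < n\<^sub>2 \<and> n\<^sub>2 < n\<^sub>3 \<longrightarrow>
       ((n\<^sub>1, n\<^sub>2, n\<^sub>3) \<in> T_set lam \<beta> k \<longrightarrow>
          trimodal_EE lam e \<beta> \<rho> k n\<^sub>1 n\<^sub>2 n\<^sub>3 =
            {(x *\<^sub>R e n\<^sub>1 + y *\<^sub>R e n\<^sub>2 + z *\<^sub>R e n\<^sub>3, - x *\<^sub>R e n\<^sub>1 - y *\<^sub>R e n\<^sub>2 + z *\<^sub>R e n\<^sub>3) | x y z :: real.
               \<rho> * x\<^sup>2 * lam n\<^sub>1 + \<rho> * y\<^sup>2 * lam n\<^sub>2 + \<rho> * z\<^sup>2 * lam n\<^sub>3 + lam n\<^sub>3 + \<beta> = 0 \<and>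
               x * y * z \<noteq> 0} \<and>
          infinite (trimodal_EE lam e \<beta> \<rho> k n\<^sub>1 n\<^sub>2 n\<^sub>3)) \<and>
       ((n\<^sub>1, n\<^sub>2, n\<^sub>3) \<notin> T_set lam \<beta> k \<longrightarrow>
          trimodal_EE lam e \<beta> \<rho> k n\<^sub>1 n\<^sub>2 n\<^sub>3 = {}))"
proof -
  interpret simple_spectrum_operator D A lam e by (rule op)
  note EE = trimodal_EE_iff[OF _ _ _ \<rho> k] and inf = infinite_trimodal_EE[OF _ \<rho> k]
  \<comment> \<open>The given indices need not be increasing, so they are sorted before
    \<open>EE\<close> is applied.\<close>
  have "T_set lam \<beta> k \<noteq> {}" if nonempty: "trimodal_EE lam e \<beta> \<rho> k m\<^sub>1 m\<^sub>2 m\<^sub>3 \<noteq> {}" for m\<^sub>1 m\<^sub>2 m\<^sub>3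
  proof -
    obtain u v where "(u, v) \<in> trimodal_EE lam e \<beta> \<rho> k m\<^sub>1 m\<^sub>2 m\<^sub>3" using nonempty by auto
    then have sol: "equidistributed_solution lam e \<beta> \<rho> k u v" and "trimodal e m\<^sub>1 m\<^sub>2 m\<^sub>3 u v"
      by (auto simp: trimodal_EE_def)
    from this(2) obtain n\<^sub>1 n\<^sub>2 n\<^sub>3
      where n: "1 \<le> n\<^sub>1" "n\<^sub>1 < n\<^sub>2" "n\<^sub>2 < n\<^sub>3" "trimodal e n\<^sub>1 n\<^sub>2 n\<^sub>3 u v"
      by (rule trimodal_ordered)
    with sol have "(u, v) \<in> trimodal_EE lam e \<beta> \<rho> k n\<^sub>1 n\<^sub>2 n\<^sub>3" by (simp add: trimodal_EE_def)
    then show ?thesis unfolding EE[OF n(1-3)] by blast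
  qed
  moreover have "\<exists>n\<^sub>1 n\<^sub>2 n\<^sub>3. trimodal_EE lam e \<beta> \<rho> k n\<^sub>1 n\<^sub>2 n\<^sub>3 \<noteq> {}" if "T_set lam \<beta> k \<noteq> {}"
    using that inf by (metis ex_in_conv finite.emptyI surj_pair)
  ultimately have "(\<exists>n\<^sub>1 n\<^sub>2 n\<^sub>3. trimodal_EE lam e \<beta> \<rho> k n\<^sub>1 n\<^sub>2 n\<^sub>3 \<noteq> {}) \<longleftrightarrow> T_set lam \<beta> k \<noteq> {}"
    by blast
  \<comment> \<open>Membership in \<open>T_set\<close> stays inside the comprehension, so that this
    one equation covers both cases: the ellipsoid family or the empty set.\<close>
  moreover have "trimodal_EE lam e \<beta> \<rho> k n\<^sub>1 n\<^sub>2 n\<^sub>3 = {(u, v). (n\<^sub>1, n\<^sub>2, n\<^sub>3) \<in> T_set lam \<beta> k \<and>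
      (\<exists>x y z. u = x *\<^sub>R e n\<^sub>1 + y *\<^sub>R e n\<^sub>2 + z *\<^sub>R e n\<^sub>3 \<and>
        v = - x *\<^sub>R e n\<^sub>1 - y *\<^sub>R e n\<^sub>2 + z *\<^sub>R e n\<^sub>3 \<and>
        \<rho> * x\<^sup>2 * lam n\<^sub>1 + \<rho> * y\<^sup>2 * lam n\<^sub>2 + \<rho> * z\<^sup>2 * lam n\<^sub>3 + lam n\<^sub>3 + \<beta> = 0 \<and> x * y * z \<noteq> 0)}"
    if "1 \<le> n\<^sub>1 \<and> n\<^sub>1 < n\<^sub>2 \<and> n\<^sub>2 < n\<^sub>3" for n\<^sub>1 n\<^sub>2 n\<^sub>3
    using EE[of n\<^sub>1 n\<^sub>2 n\<^sub>3 _ _ \<beta>] that by (intro set_eqI) (simp only: split_paired_all mem_Collect_eq case_prod_conv)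
  ultimately show ?thesis
    using inf by (intro conjI allI impI) (blast | simp)+
qed

end
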